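(* (a) Let $f\colon X\to Y$ and $g\colon Y\to Z$ be continuous maps between metric compacta, and let $\varepsilon,\delta>0$. (i) If $g$ is $\varepsilon$-crooked, then $g\circ f$ is $\varepsilon$-crooked. (ii) If $g$ is $\langle\varepsilon,\delta\rangle$-continuous and $f$ is $\delta$-crooked, then $g\circ f$ is $\varepsilon$-crooked. (b) Let $f,g\colon X\to Y$ be continuous maps between metric compacta, and let $\varepsilon,\delta>0$. (iii) If $f$ is $\varepsilon$-crooked and $g\approx_\delta f$, then $g$ is $(\varepsilon+2\delta)$-crooked.
   Context: A metric compactum is a compact metric space. For maps $f,g\colon X\to Y$ into a metric space, $f\approx_\delta g$ means $\sup_{x\in X}d(f(x),g(x))<\delta$. A map $g$ between metric spaces is $\langle\varepsilon,\delta\rangle$-continuous if $d(x,y)<\delta$ implies $d(g(x),g(y))<\varepsilon$ for all $x,y$ in its domain. Crookedness. Let $A,B,U_A,U_B$ be subsets of a Hausdorff compactum $X$. The space $X$ is crooked at the quadruple $\langle A,B,U_A,U_B\rangle$ if there is a cover $X=F_A\cup H\cup F_B$ by closed sets such that $A\subseteq F_A$, $B\subseteq F_B$, $F_A\cap H\subseteq U_B$, $F_B\cap H\subseteq U_A$, and $F_A\cap F_B\subseteq U_A\cap U_B$. A continuous map $f\colon X\to Y$ between Hausdorff compacta is crooked at a quadruple $\langle A,B,U_A,U_B\rangle$ of subsets of $Y$ if $X$ is crooked at $\langle f^{-1}[A],f^{-1}[B],f^{-1}[U_A],f^{-1}[U_B]\rangle$. If $Y$ is metric and $\varepsilon>0$,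 then $f$ is $\varepsilon$-crooked at $\langle A,B\rangle$ if it is crooked at $\langle A,B,N_\varepsilon(A),N_\varepsilon(B)\rangle$, where $N_\varepsilon(A)=\{y\in Y: d(y,A)<\varepsilon\}$ (with $N_\varepsilon(\emptyset)=\emptyset$). The map $f$ is $\varepsilon$-crooked if it is $\varepsilon$-crooked at every pair $\langle A,B\rangle$ of closed subsets of $Y$. *)

theory Defs
  imports "HOL-Analysis.Analysis"
begin

text \<open>Metric spaces are objects of the library type \<^typ>\<open>'a metric\<close>, so a metric compactum is
  an \<^term>\<open>M :: 'a metric\<close> with \<^term>\<open>compact_space (mtopology_of M)\<close> (possibly empty). A map is
  a HOL function of which only the values on the domain's carrier matter.\<close>

definition crooked_space_at ::
  "'a topology \<Rightarrow> 'a set \<Rightarrow> 'a set \<Rightarrow> 'a set \<Rightarrow> 'a set \<Rightarrow> bool" where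
  "crooked_space_at X A B U\<^sub>A U\<^sub>B \<longleftrightarrow>
     (\<exists>F\<^sub>A H F\<^sub>B. closedin X F\<^sub>A \<and> closedin X H \<and> closedin X F\<^sub>B \<and>
        topspace X = F\<^sub>A \<union> H \<union> F\<^sub>B \<and>
        A \<subseteq> F\<^sub>A \<and> B \<subseteq> F\<^sub>B \<and>
        F\<^sub>A \<inter> H \<subseteq> U\<^sub>B \<and> F\<^sub>B \<inter> H \<subseteq> U\<^sub>A \<and>
        F\<^sub>A \<inter> F\<^sub>B \<subseteq> U\<^sub>A \<inter> U\<^sub>B)"

definition preimage_on :: "'a topology \<Rightarrow> ('a \<Rightarrow> 'b) \<Rightarrow> 'b set \<Rightarrow> 'a set" where
  "preimage_on X f S = {x \<in> topspace X. f x \<in> S}"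

definition crooked_map_at ::
  "'a topology \<Rightarrow> ('a \<Rightarrow> 'b) \<Rightarrow> 'b set \<Rightarrow> 'b set \<Rightarrow> 'b set \<Rightarrow> 'b set \<Rightarrow> bool" where
  "crooked_map_at X f A B U\<^sub>A U\<^sub>B \<longleftrightarrow>
     crooked_space_at X (preimage_on X f A) (preimage_on X f B)
       (preimage_on X f U\<^sub>A) (preimage_on X f U\<^sub>B)"

text \<open>The conjunct \<^term>\<open>A \<noteq> {}\<close> is needed: the infimum of the empty set of reals is an
  unspecified number, whereas the neighbourhood of the empty set is to be empty.\<close>

definition metric_nbhd :: "'a metric \<Rightarrow> real \<Rightarrow> 'a set \<Rightarrow> 'a set" where
  "metric_nbhd M \<epsilon> A = {y \<in> mspace M. A \<noteq> {} \<and> (INF a\<in>A. mdist M y a) < \<epsilon>}"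

definition eps_crooked_at ::
  "'a topology \<Rightarrow> 'b metric \<Rightarrow> real \<Rightarrow> ('a \<Rightarrow> 'b) \<Rightarrow> 'b set \<Rightarrow> 'b set \<Rightarrow> bool" where
  "eps_crooked_at X Y \<epsilon> f A B \<longleftrightarrow>
     crooked_map_at X f A B (metric_nbhd Y \<epsilon> A) (metric_nbhd Y \<epsilon> B)"

definition eps_crooked :: "'a topology \<Rightarrow> 'b metric \<Rightarrow> real \<Rightarrow> ('a \<Rightarrow> 'b) \<Rightarrow> bool" where
  "eps_crooked X Y \<epsilon> f \<longleftrightarrow>
     (\<forall>A B. closedin (mtopology_of Y) A \<and> closedin (mtopology_of Y) B \<longrightarrow> eps_crooked_at X Y \<epsilon> f A B)"

definition eps_delta_continuous ::
  "'a metric \<Rightarrow> 'b metric \<Rightarrow> real \<Rightarrow> real \<Rightarrow> ('a \<Rightarrow> 'b) \<Rightarrow> bool" where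
  "eps_delta_continuous X Y \<epsilon> \<delta> g \<longleftrightarrow>
     (\<forall>x\<in>mspace X. \<forall>y\<in>mspace X. mdist X x y < \<delta> \<longrightarrow> mdist Y (g x) (g y) < \<epsilon>)"

text \<open>The supremum is taken in \<^typ>\<open>ennreal\<close>, where it is \<open>0\<close> on an empty domain and
  \<open>\<infinity>\<close> for an unbounded family; real suprema are unspecified in both cases.\<close>

definition uniformly_near :: "'a set \<Rightarrow> 'b metric \<Rightarrow> real \<Rightarrow> ('a \<Rightarrow> 'b) \<Rightarrow> ('a \<Rightarrow> 'b) \<Rightarrow> bool" where
  "uniformly_near S Y \<delta> f g \<longleftrightarrow> (SUP x\<in>S. ennreal (mdist Y (f x) (g x))) < ennreal \<delta>"

end

theory Submission
  imports Defs
begin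

text \<open>Witnesses of crookedness pull back along continuous maps, and they survive shrinking
  \<open>A\<close>, \<open>B\<close> and enlarging the neighbourhoods. For (ii), \<open>f\<close> is \<open>\<delta>\<close>-crooked at
  the preimages of the given sets under \<open>g\<close>; for (iii), \<open>f\<close> is \<open>\<epsilon>\<close>-crooked at the sets
  \<open>f[g\<^sup>-\<^sup>1[A]]\<close> and \<open>f[g\<^sup>-\<^sup>1[B]]\<close>, which are closed by compactness.\<close>

text \<open>Distances are bounded below by 0, so an infimum over a nonempty set lies strictly below
  \<open>\<epsilon>\<close> exactly when some member does; the infimum need not be attained. For
  \<open>A = {}\<close> both sides are false, so no nonemptiness condition is carried along
  later.\<close>

lemma metric_nbhd_iff:
  "y \<in> metric_nbhd M \<epsilon> A \<longleftrightarrow> y \<in> mspace M \<and> (\<exists>a\<in>A. mdist M y a < \<epsilon>)"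
proof (cases "A = {}")
  case False
  moreover have "bdd_below (mdist M y ` A)"
    by (rule bdd_belowI[of _ 0]) auto
  ultimately show ?thesis
    by (simp add: metric_nbhd_def cINF_less_iff)
qed (simp add: metric_nbhd_def)

lemma crooked_space_at_mono:
  assumes "crooked_space_at X A B U V"
    and "A' \<subseteq> A" "B' \<subseteq> B" "U \<subseteq> U'" "V \<subseteq> V'"
  shows "crooked_space_at X A' B' U' V'"
proof -
  obtain F H G where *: "closedin X F" "closedin X H" "closedin X G" "topspace X = F \<union> H \<union> G"
    and sub: "A \<subseteq> F" "B \<subseteq> G" "F \<inter> H \<subseteq> V" "G \<inter> H \<subseteq> U" "F \<inter> G \<subseteq> U \<inter> V"
    using assms(1) unfolding crooked_space_at_def by blast
  have "A' \<subseteq> F" "B' \<subseteq> G" "F \<inter> H \<subseteq> V'" "G \<inter> H \<subseteq> U'" "F \<inter> G \<subseteq> U' \<inter> V'"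
    using sub assms(2-) by blast+
  with * show ?thesis
    unfolding crooked_space_at_def by blast
qed

lemma closedin_preimage_on:
  assumes "continuous_map X Y f" "closedin Y C"
  shows "closedin X (preimage_on X f C)"
  using closedin_continuous_map_preimage[OF assms] by (simp add: preimage_on_def)

lemma crooked_space_at_preimage:
  assumes f: "continuous_map X Y f" and "crooked_space_at Y A B U V"
  shows "crooked_space_at X (preimage_on X f A) (preimage_on X f B)
           (preimage_on X f U) (preimage_on X f V)"
proof -
  obtain F H G where closed: "closedin Y F" "closedin Y H" "closedin Y G"
    and cover: "topspace Y = F \<union> H \<union> G"
    and sub: "A \<subseteq> F" "B \<subseteq> G" "F \<inter> H \<subseteq> V" "G \<inter> H \<subseteq> U" "F \<inter> G \<subseteq> U \<inter> V"
    using assms(2) unfolding crooked_space_at_def by blast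
  \<comment> \<open>The pulled-back sets cover because \<open>f\<close> sends
    \<open>topspace X\<close> into \<open>topspace Y\<close>.\<close>
  have "topspace X = preimage_on X f F \<union> preimage_on X f H \<union> preimage_on X f G"
    using continuous_map_funspace[OF f] unfolding cover by (auto simp: preimage_on_def)
  moreover have "preimage_on X f A \<subseteq> preimage_on X f F" "preimage_on X f B \<subseteq> preimage_on X f G"
    "preimage_on X f F \<inter> preimage_on X f H \<subseteq> preimage_on X f V"
    "preimage_on X f G \<inter> preimage_on X f H \<subseteq> preimage_on X f U"
    "preimage_on X f F \<inter> preimage_on X f G \<subseteq> preimage_on X f U \<inter> preimage_on X f V"
    using sub unfolding preimage_on_def by blast+
  ultimately show ?thesis
    unfolding crooked_space_at_def using closed[THEN closedin_preimage_on[OF f]] by blast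
qed

text \<open>Preimages are cut down to the carrier, so functoriality rests on \<open>f\<close>
  sending \<open>topspace X\<close> into \<open>topspace Y\<close>: otherwise the right-hand side
  could lose points.\<close>

lemma preimage_on_comp:
  assumes "continuous_map X Y f"
  shows "preimage_on X (g \<circ> f) S = preimage_on X f (preimage_on Y g S)"
  using continuous_map_funspace[OF assms] by (auto simp: preimage_on_def)

lemma eps_crooked_comp_left:
  assumes "continuous_map X Y f" "eps_crooked Y Z \<epsilon> g"
  shows "eps_crooked X Z \<epsilon> (g \<circ> f)"
  using assms crooked_space_at_preimage[OF assms(1)]
  by (simp add: eps_crooked_def eps_crooked_at_def crooked_map_at_def
      preimage_on_comp[OF assms(1)])

text \<open>Common core of (ii) and (iii). The replacement \<open>A'\<close> depends on one closed
  set only, so it can be chosen for \<open>A\<close> and \<open>B\<close> separately; monotonicity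
  then turns the witnesses for \<open>A'\<close>, \<open>B'\<close> under \<open>f\<close> into
  witnesses for \<open>A\<close>, \<open>B\<close> under \<open>h\<close>.\<close>

lemma eps_crooked_transfer:
  assumes f: "eps_crooked X Y \<delta> f"
    and enlarge: "\<And>A. closedin (mtopology_of Z) A \<Longrightarrow>
       \<exists>A'. closedin (mtopology_of Y) A' \<and> preimage_on X h A \<subseteq> preimage_on X f A' \<and>
         preimage_on X f (metric_nbhd Y \<delta> A') \<subseteq> preimage_on X h (metric_nbhd Z \<epsilon> A)"
  shows "eps_crooked X Z \<epsilon> h"
  unfolding eps_crooked_def eps_crooked_at_def crooked_map_at_def
proof (intro allI impI, elim conjE)
  fix A B
  assume "closedin (mtopology_of Z) A" "closedin (mtopology_of Z) B"
  then obtain A' B' where A': "closedin (mtopology_of Y) A'"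
      "preimage_on X h A \<subseteq> preimage_on X f A'"
      "preimage_on X f (metric_nbhd Y \<delta> A') \<subseteq> preimage_on X h (metric_nbhd Z \<epsilon> A)"
    and B': "closedin (mtopology_of Y) B'"
      "preimage_on X h B \<subseteq> preimage_on X f B'"
      "preimage_on X f (metric_nbhd Y \<delta> B') \<subseteq> preimage_on X h (metric_nbhd Z \<epsilon> B)"
    using enlarge by meson
  have "crooked_space_at X (preimage_on X f A') (preimage_on X f B')
      (preimage_on X f (metric_nbhd Y \<delta> A')) (preimage_on X f (metric_nbhd Y \<delta> B'))"
    using f A'(1) B'(1) by (simp add: eps_crooked_def eps_crooked_at_def crooked_map_at_def)
  then show "crooked_space_at X (preimage_on X h A) (preimage_on X h B)
      (preimage_on X h (metric_nbhd Z \<epsilon> A)) (preimage_on X h (metric_nbhd Z \<epsilon> B))"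
    by (rule crooked_space_at_mono[OF _ A'(2) B'(2) A'(3) B'(3)])
qed

lemma eps_crooked_comp_right:
  assumes f: "continuous_map X (mtopology_of Y) f"
    and g: "continuous_map (mtopology_of Y) (mtopology_of Z) g"
    and cont: "eps_delta_continuous Y Z \<epsilon> \<delta> g" and crooked: "eps_crooked X Y \<delta> f"
  shows "eps_crooked X Z \<epsilon> (g \<circ> f)"
proof (rule eps_crooked_transfer[OF crooked])
  fix A assume A: "closedin (mtopology_of Z) A"
  let ?A' = "preimage_on (mtopology_of Y) g A"
  \<comment> \<open>If \<open>y\<close> is within \<open>\<delta>\<close> of a point
    \<open>a\<close> with \<open>g a\<close> in \<open>A\<close>, then \<open>g y\<close> is within
    \<open>\<epsilon>\<close> of \<open>g a\<close>.\<close>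
  have "metric_nbhd Y \<delta> ?A' \<subseteq> preimage_on (mtopology_of Y) g (metric_nbhd Z \<epsilon> A)"
    using cont continuous_map_funspace[OF g]
    by (fastforce simp: metric_nbhd_iff preimage_on_def eps_delta_continuous_def)
  then have "preimage_on X f (metric_nbhd Y \<delta> ?A') \<subseteq> preimage_on X (g \<circ> f) (metric_nbhd Z \<epsilon> A)"
    unfolding preimage_on_comp[OF f] by (auto simp: preimage_on_def)
  then show "\<exists>A'. closedin (mtopology_of Y) A' \<and> preimage_on X (g \<circ> f) A \<subseteq> preimage_on X f A' \<and>
      preimage_on X f (metric_nbhd Y \<delta> A') \<subseteq> preimage_on X (g \<circ> f) (metric_nbhd Z \<epsilon> A)"
    using closedin_preimage_on[OF g A] preimage_on_comp[OF f] by blast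
qed

text \<open>Each term is at most the supremum; as \<open>mdist\<close> is nonnegative, the strict
  inequality passes from \<open>ennreal\<close> back to the reals.\<close>

lemma uniformly_near_mdist_less:
  assumes "uniformly_near S Y \<delta> f g" "x \<in> S"
  shows "mdist Y (f x) (g x) < \<delta>"
proof -
  have "ennreal (mdist Y (f x) (g x)) < ennreal \<delta>"
    using assms unfolding uniformly_near_def by (meson SUP_upper order_le_less_trans)
  then show ?thesis
    by (simp add: ennreal_less_iff)
qed

lemma Hausdorff_space_mtopology_of: "Hausdorff_space (mtopology_of M)"
  by (simp add: mtopology_of_def Metric_space.Hausdorff_space_mtopology[OF Metric_space_mspace_mdist])

lemma eps_crooked_uniformly_near:
  assumes X: "compact_space X"
    and f: "continuous_map X (mtopology_of Y) f"
    and g: "continuous_map X (mtopology_of Y) g"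
    and crooked: "eps_crooked X Y \<epsilon> f" and near: "uniformly_near (topspace X) Y \<delta> g f"
  shows "eps_crooked X Y (\<epsilon> + 2 * \<delta>) g"
proof (rule eps_crooked_transfer[OF crooked])
  fix A assume A: "closedin (mtopology_of Y) A"
  let ?P = "preimage_on X g A"
  \<comment> \<open>This is the least set whose preimage under \<open>f\<close> contains
    \<open>?P\<close>. Continuity of \<open>f\<close> alone would not make it closed; compactness of
    \<open>X\<close> and the Hausdorff property of \<open>Y\<close> do.\<close>
  let ?A' = "f ` ?P"
  have "compactin X ?P"
    using X closedin_preimage_on[OF g A] by (rule closedin_compact_space)
  then have "closedin (mtopology_of Y) ?A'"
    by (intro compactin_imp_closedin image_compactin[OF _ f] Hausdorff_space_mtopology_of)
  moreover have "preimage_on X g A \<subseteq> preimage_on X f ?A'"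
    by (auto simp: preimage_on_def)
  moreover have "preimage_on X f (metric_nbhd Y \<epsilon> ?A') \<subseteq>
      preimage_on X g (metric_nbhd Y (\<epsilon> + 2 * \<delta>) A)"
  proof
    fix x assume "x \<in> preimage_on X f (metric_nbhd Y \<epsilon> ?A')"
    \<comment> \<open>A point of \<open>?A'\<close> close to \<open>f x\<close> has the form
      \<open>f x'\<close> with \<open>g x'\<close> in \<open>A\<close>; this \<open>g x'\<close>
      will be the point of \<open>A\<close> close to \<open>g x\<close>.\<close>
    then obtain x' where x: "x \<in> topspace X" and x': "x' \<in> topspace X" "g x' \<in> A"
      and less: "mdist Y (f x) (f x') < \<epsilon>"
      by (auto simp: preimage_on_def metric_nbhd_iff)
    have sp: "f x \<in> mspace Y" "f x' \<in> mspace Y" "g x \<in> mspace Y" "g x' \<in> mspace Y"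
      using continuous_map_funspace[OF f] continuous_map_funspace[OF g] x x' by auto
    \<comment> \<open>The path runs from \<open>g x\<close> via \<open>f x\<close> and
      \<open>f x'\<close> to \<open>g x'\<close>. Both outer legs compare \<open>g\<close> with
      \<open>f\<close> at a single point, at \<open>x\<close> and at \<open>x'\<close>, whence the
      summand \<open>2 * \<delta>\<close>.\<close>
    have "mdist Y (g x) (g x') \<le> mdist Y (g x) (f x) + mdist Y (f x) (f x') + mdist Y (f x') (g x')"
      using mdist_triangle[of "g x" Y "f x" "g x'"] mdist_triangle[of "f x" Y "f x'" "g x'"] sp
      by simp
    also have "\<dots> < \<delta> + \<epsilon> + \<delta>"
      using uniformly_near_mdist_less[OF near x] uniformly_near_mdist_less[OF near x'(1)] less
      by (simp add: mdist_commute)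
    finally show "x \<in> preimage_on X g (metric_nbhd Y (\<epsilon> + 2 * \<delta>) A)"
      using x x' sp by (auto simp: preimage_on_def metric_nbhd_iff algebra_simps)
  qed
  ultimately show "\<exists>A'. closedin (mtopology_of Y) A' \<and> preimage_on X g A \<subseteq> preimage_on X f A' \<and>
      preimage_on X f (metric_nbhd Y \<epsilon> A') \<subseteq> preimage_on X g (metric_nbhd Y (\<epsilon> + 2 * \<delta>) A)"
    by blast
qed

theorem proposition2p7:
  shows "(\<forall>(X :: 'a metric) (Y :: 'b metric) (Z :: 'c metric) (f :: 'a \<Rightarrow> 'b) (g :: 'b \<Rightarrow> 'c)
            (\<epsilon> :: real) (\<delta> :: real).
            compact_space (mtopology_of X) \<and> compact_space (mtopology_of Y) \<and>
            compact_space (mtopology_of Z) \<and>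
            continuous_map (mtopology_of X) (mtopology_of Y) f \<and>
            continuous_map (mtopology_of Y) (mtopology_of Z) g \<and>
            \<epsilon> > 0 \<and> \<delta> > 0 \<longrightarrow>
              (eps_crooked (mtopology_of Y) Z \<epsilon> g \<longrightarrow>
                 eps_crooked (mtopology_of X) Z \<epsilon> (g \<circ> f)) \<and>
              (eps_delta_continuous Y Z \<epsilon> \<delta> g \<and> eps_crooked (mtopology_of X) Y \<delta> f \<longrightarrow>
                 eps_crooked (mtopology_of X) Z \<epsilon> (g \<circ> f)))
       \<and> (\<forall>(X :: 'a metric) (Y :: 'b metric) (f :: 'a \<Rightarrow> 'b) (g :: 'a \<Rightarrow> 'b)
            (\<epsilon> :: real) (\<delta> :: real).
            compact_space (mtopology_of X) \<and> compact_space (mtopology_of Y) \<and>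
            continuous_map (mtopology_of X) (mtopology_of Y) f \<and>
            continuous_map (mtopology_of X) (mtopology_of Y) g \<and>
            \<epsilon> > 0 \<and> \<delta> > 0 \<longrightarrow>
              (eps_crooked (mtopology_of X) Y \<epsilon> f \<and> uniformly_near (mspace X) Y \<delta> g f \<longrightarrow>
                 eps_crooked (mtopology_of X) Y (\<epsilon> + 2 * \<delta>) g))"
  by (intro conjI allI impI; elim conjE)
    (auto intro: eps_crooked_comp_left eps_crooked_comp_right eps_crooked_uniformly_near)

end
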